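(* Let $A : \mathbb{R}^m \to \mathbb{R}^n$ be a linear operator whose matrix (in the canonical bases) has all its coefficients in $\{-1,0,1\}$. Suppose there exists an integer $k$ such that every column and every row of this matrix has at most $k$ non-zero coefficients. Then there exists a linear operator $B : \mathbb{R}^n \to \mathbb{R}^m$ such that $ABAv = Av$ for any $v \in \mathbb{R}^m$ and $$\|Bu\|^2 \leq n\, k^{2n}\, \|u\|^2$$ for any $u \in \mathbb{R}^n$.
   Context: $\|\cdot\|$ denotes the standard Euclidean norm on $\mathbb{R}^m$ and $\mathbb{R}^n$. *)

theory Defs
  imports "HOL-Analysis.Analysis"
begin

end

theory Submission
  imports Defs
begin

text \<open>
  The range of \<open>A\<close> is spanned by some linearly independent set \<open>S\<close> of columns of its matrix. Adding
  suitable unit vectors to \<open>S\<close> gives a basis of the whole space; take its members as the rows of a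
  square matrix \<open>M\<close>. Expand \<open>u\<close> in this basis and let \<open>B u\<close> be the combination of those domain unit
  vectors that \<open>A\<close> sends to the elements of \<open>S\<close>, with the same coefficients; the coefficients at the
  added unit vectors are dropped. A vector \<open>u\<close> in the range of \<open>A\<close> lies in the span of \<open>S\<close>, so nothing
  is dropped for it and \<open>A (B u) = u\<close>.

  The norm of \<open>B u\<close> is controlled by the coefficients of \<open>u\<close>. By Cramer's rule the coefficient at the
  row \<open>l\<close> of \<open>M\<close> is the determinant of \<open>M\<close> with that row replaced by \<open>u\<close>, divided by \<open>det M\<close>. The
  denominator is a nonzero integer, so it can only help
  (\<open>abs_det_ge_1_if_integral\<close>). The numerator is bounded by the norm of \<open>u\<close> times the product
  of the \<open>l\<^sub>1\<close>-norms of the other rows (\<open>abs_det_le_norm_row_times_l1_rows\<close>); each of these rows is a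
  column of \<open>A\<close> or a unit vector, so its \<open>l\<^sub>1\<close>-norm is at most \<open>k\<close> as soon as \<open>k \<ge> 1\<close>. Hence every
  coefficient is at most \<open>k ^ (n - 1)\<close> times the norm of \<open>u\<close>, and there are at most \<open>n\<close> of them. If
  \<open>k \<le> 0\<close>, then \<open>A = 0\<close> and \<open>B = 0\<close> will do.
\<close>

text \<open>
  In the permutation expansion, bound the factor from row \<open>l\<close> by the norm of that row. What remains
  are products of entries over the rows other than \<open>l\<close>. A permutation is determined by its values off
  \<open>l\<close>, so these products are distinct terms of the fully expanded product of the \<open>l\<^sub>1\<close>-norms.
\<close>

lemma abs_det_le_norm_row_times_l1_rows:
  fixes M :: "real ^ 'n ^ 'n"
  shows "\<bar>det M\<bar> \<le> norm (M $ l) * (\<Prod>i\<in>UNIV - {l}. \<Sum>j\<in>UNIV. \<bar>M $ i $ j\<bar>)"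
proof -
  let ?R = "UNIV - {l}"
  let ?P = "{p. p permutes (UNIV :: 'n set)}"
  let ?w = "\<lambda>g. \<Prod>i\<in>?R. \<bar>M $ i $ g i\<bar>"
  have "\<bar>det M\<bar> \<le> (\<Sum>p\<in>?P. \<Prod>i\<in>UNIV. \<bar>M $ i $ p i\<bar>)"
    unfolding det_def
    by (rule order_trans[OF sum_abs]) (auto intro!: sum_mono simp: abs_mult abs_prod sign_def)
  also have "\<dots> = (\<Sum>p\<in>?P. \<bar>M $ l $ p l\<bar> * ?w p)"
    by (intro sum.cong refl prod.remove) auto
  also have "\<dots> \<le> (\<Sum>p\<in>?P. norm (M $ l) * ?w p)"
    by (intro sum_mono mult_right_mono component_le_norm_cart prod_nonneg) auto
  also have "\<dots> = norm (M $ l) * (\<Sum>p\<in>?P. ?w p)"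
    by (simp add: sum_distrib_left)
  also have "(\<Sum>p\<in>?P. ?w p) \<le> (\<Sum>g\<in>?R \<rightarrow>\<^sub>E UNIV. ?w g)"
  proof -
    have inj: "inj_on (\<lambda>p. restrict p ?R) ?P"
    proof (rule inj_onI)
      fix p q :: "'n \<Rightarrow> 'n"
      assume p: "p \<in> ?P" and q: "q \<in> ?P" and eq: "restrict p ?R = restrict q ?R"
      have off: "p i = q i" if "i \<noteq> l" for i
        using fun_cong[OF eq, of i] that by simp
      \<comment> \<open>The value \<open>q l\<close> is taken by \<open>p\<close> somewhere; at a point other than \<open>l\<close> it would be taken by \<open>q\<close>
        as well, against injectivity.\<close>
      obtain i where i: "p i = q l"
        using p permutes_surj by (metis mem_Collect_eq surjD)
      have "i = l"
        using off[of i] i q permutes_inj by (metis injD mem_Collect_eq)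
      with i off show "p = q" by (intro ext) metis
    qed
    have "(\<Sum>p\<in>?P. ?w p) = (\<Sum>g\<in>(\<lambda>p. restrict p ?R) ` ?P. ?w g)"
      by (subst sum.reindex[OF inj]) (auto intro!: sum.cong prod.cong)
    also have "\<dots> \<le> (\<Sum>g\<in>?R \<rightarrow>\<^sub>E UNIV. ?w g)"
      by (intro sum_mono2 finite_PiE prod_nonneg) auto
    finally show ?thesis .
  qed
  also have "(\<Sum>g\<in>?R \<rightarrow>\<^sub>E UNIV. ?w g) = (\<Prod>i\<in>?R. \<Sum>j\<in>UNIV. \<bar>M $ i $ j\<bar>)"
    by (rule prod_sum_PiE[symmetric]) auto
  finally show ?thesis by (simp add: mult_left_mono)
qed

lemma abs_det_ge_1_if_integral:
  fixes M :: "real ^ 'n ^ 'n"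
  assumes "\<And>i j. M $ i $ j \<in> \<int>" and "det M \<noteq> 0"
  shows "1 \<le> \<bar>det M\<bar>"
proof -
  have "det M \<in> \<int>"
    unfolding det_def using assms(1) by (intro Ints_sum Ints_mult Ints_prod) auto
  then show ?thesis using assms(2) Ints_nonzero_abs_ge1 by blast
qed

text \<open>Cramer's rule turns the two determinant estimates into a bound on coordinates.\<close>

lemma abs_coordinate_le_integral_basis:
  fixes M :: "real ^ 'n ^ 'n" and x :: "real ^ 'n"
  assumes int: "\<And>i j. M $ i $ j \<in> \<int>" and nz: "det M \<noteq> 0"
    and l1: "\<And>i. (\<Sum>j\<in>UNIV. \<bar>M $ i $ j\<bar>) \<le> c"
  shows "\<bar>x $ l\<bar> \<le> c ^ (CARD('n) - 1) * norm (x v* M)"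
proof -
  let ?N = "(\<chi> i. if i = l then x v* M else row i M) :: real ^ 'n ^ 'n"
  have "x v* M = (\<Sum>i\<in>UNIV. x $ i *s row i M)"
    by (simp add: vec_eq_iff vector_matrix_mult_def row_def)
  then have cramer: "det ?N = x $ l * det M"
    using cramer_lemma_transpose[of l x M] by (simp only:)
  have "\<bar>x $ l\<bar> \<le> \<bar>x $ l\<bar> * \<bar>det M\<bar>"
    using abs_det_ge_1_if_integral[OF int nz] by (simp add: mult_le_cancel_left1)
  also have "\<dots> = \<bar>det ?N\<bar>"
    by (simp add: cramer abs_mult)
  also have "\<dots> \<le> norm (?N $ l) * (\<Prod>i\<in>UNIV - {l}. \<Sum>j\<in>UNIV. \<bar>?N $ i $ j\<bar>)"
    by (rule abs_det_le_norm_row_times_l1_rows)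
  also have "(\<Prod>i\<in>UNIV - {l}. \<Sum>j\<in>UNIV. \<bar>?N $ i $ j\<bar>) \<le> (\<Prod>i\<in>UNIV - {l}. c)"
    using l1 by (intro prod_mono) (auto simp: row_def sum_nonneg)
  finally show ?thesis
    by (simp add: mult_right_mono mult.commute card_Diff_singleton)
qed

text \<open>
  Completing with unit vectors, rather than with arbitrary vectors, keeps the matrix integral and
  its rows small.
\<close>

lemma independent_extends_to_rows_by_unit_vectors:
  fixes S :: "(real ^ 'n) set"
  assumes "independent S"
  obtains M :: "real ^ 'n ^ 'n"
  where "det M \<noteq> 0" "inj (($) M)" "range (($) M) \<subseteq> S \<union> Basis" "S \<subseteq> range (($) M)"
proof -
  obtain T where T: "S \<subseteq> T" "T \<subseteq> S \<union> Basis" "independent T" "S \<union> Basis \<subseteq> span T"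
    using maximal_independent_subset_extend[of S "S \<union> Basis"] assms by blast
  have spanT: "span T = UNIV"
  proof -
    have "span Basis \<subseteq> span T"
      using T(4) by (intro span_minimal) (auto simp: subspace_span)
    then show ?thesis by auto
  qed
  have "card T = CARD('n)"
    using dim_eq_card[of T UNIV] T(3) spanT by simp
  then obtain f :: "'n \<Rightarrow> real ^ 'n" where f: "bij_betw f UNIV T"
    using finite_same_card_bij[of "UNIV :: 'n set" T] T(3) independent_imp_finite by fastforce
  define M where "M = (\<chi> i. f i)"
  have Mf: "(($) M) = f" by (simp add: M_def fun_eq_iff)
  have "rows M = T"
    using f Mf by (auto simp: rows_def row_def bij_betw_def)
  then have "det M \<noteq> 0"
    using matrix_left_invertible_span_rows[of M] spanT
    by (simp add: invertible_det_nz[symmetric] invertible_left_inverse)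
  then show ?thesis
    using that[of M] f T(1,2) by (simp add: Mf bij_betw_def)
qed

text \<open>
  The coordinate bound is applied to a basis made of columns of \<open>A\<close> and of unit vectors. The
  requirement \<open>1 \<le> c\<close> makes \<open>c\<close> bound the \<open>l\<^sub>1\<close>-norms of the latter too.
\<close>

lemma integral_operator_has_bounded_generalized_inverse:
  fixes A :: "real ^ 'm \<Rightarrow> real ^ 'n"
  assumes lin: "linear A" and int: "\<And>i j. matrix A $ i $ j \<in> \<int>" and c: "1 \<le> c"
    and l1: "\<And>j. (\<Sum>i\<in>UNIV. \<bar>matrix A $ i $ j\<bar>) \<le> c"
  obtains B :: "real ^ 'n \<Rightarrow> real ^ 'm"
  where "linear B" "\<And>v. A (B (A v)) = A v"
    "\<And>u. (norm (B u))\<^sup>2 \<le> real CARD('n) * (c ^ (CARD('n) - 1) * norm u)\<^sup>2"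
proof -
  define col where "col j = A (axis j 1)" for j
  have col: "col j $ i = matrix A $ i $ j" for i j
    by (simp add: col_def matrix_def)
  obtain S where S: "S \<subseteq> range col" "independent S" "range col \<subseteq> span S"
    using maximal_independent_subset by blast
  obtain M :: "real ^ 'n ^ 'n" where nz: "det M \<noteq> 0" and inj: "inj (($) M)"
    and sub: "range (($) M) \<subseteq> S \<union> Basis" and sup: "S \<subseteq> range (($) M)"
    using independent_extends_to_rows_by_unit_vectors[OF S(2)] .
  have row_cases: "(\<exists>j. M $ i = col j) \<or> (\<exists>j. M $ i = axis j 1)" for i
  proof -
    have "M $ i \<in> range col \<union> Basis" using sub S(1) by blast
    then show ?thesis by (auto simp: Basis_vec_def)
  qed
  have M_int: "M $ i $ j \<in> \<int>" for i j
    using row_cases[of i] by (auto simp: col int axis_def)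
  have M_l1: "(\<Sum>j\<in>UNIV. \<bar>M $ i $ j\<bar>) \<le> c" for i
    using row_cases[of i]
  proof (elim disjE exE)
    fix j assume "M $ i = col j"
    then show ?thesis by (simp add: col l1)
  next
    fix j assume "M $ i = axis j 1"
    then show ?thesis using c by (simp add: axis_def if_distrib[of abs] cong: if_cong)
  qed
  obtain N where NM: "N ** M = mat 1" and MN: "M ** N = mat 1"
    using nz unfolding invertible_det_nz[symmetric] invertible_def by blast
  have coord: "\<bar>(u v* N) $ i\<bar> \<le> c ^ (CARD('n) - 1) * norm u" for u i
    using abs_coordinate_le_integral_basis[OF M_int nz M_l1, of "u v* N" i]
    by (simp add: vector_matrix_mul_assoc NM)
  define I where "I = {i. M $ i \<in> S}"
  define h where "h i = (SOME j. col j = M $ i)" for i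
  have h: "col (h i) = M $ i" if "i \<in> I" for i
  proof -
    have "\<exists>j. col j = M $ i" using that S(1) by (force simp: I_def)
    then show ?thesis unfolding h_def by (rule someI_ex)
  qed
  have h_inj: "inj_on h I"
  proof (rule inj_onI)
    fix i i' assume "i \<in> I" "i' \<in> I" "h i = h i'"
    then have "M $ i = M $ i'" using h by metis
    then show "i = i'" by (rule injD[OF inj])
  qed
  define B where "B u = (\<Sum>i\<in>I. (u v* N) $ i *\<^sub>R axis (h i) (1::real))" for u :: "real ^ 'n"
  have linB: "linear B"
    unfolding B_def
    by (intro linearI)
       (simp_all add: vector_matrix_left_distrib scaleR_vector_matrix_assoc
          scaleR_left_distrib sum.distrib scaleR_sum_right)
  have "A (B w) = w" if "w \<in> span S" for w
  proof -
    \<comment> \<open>Both sides are linear in \<open>w\<close>, so it suffices to look at the elements of \<open>S\<close>, whose coordinate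
      vectors are unit vectors.\<close>
    have "(A \<circ> B) w = id w"
    proof (rule linear_eq_on_span[OF _ _ _ that])
      show "linear (A \<circ> B)" using linB lin by (rule linear_compose)
      show "linear (id :: real ^ 'n \<Rightarrow> real ^ 'n)" by (rule linear_id)
      fix s assume s: "s \<in> S"
      obtain a where a: "s = M $ a" using sup s by blast
      have aI: "a \<in> I" using s a by (simp add: I_def)
      have "s v* N = (M ** N) $ a"
        by (simp add: a vec_eq_iff vector_matrix_mult_def matrix_matrix_mult_def)
      then have "(s v* N) $ i = (if i = a then 1 else 0)" for i
        by (simp add: MN mat_def)
      then have "B s = axis (h a) 1"
        using aI unfolding B_def by (simp add: if_distrib[of "\<lambda>r. r *\<^sub>R _"] cong: if_cong)
      then show "(A \<circ> B) s = id s"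
        using h[OF aI] by (simp add: a col_def)
    qed
    then show ?thesis by simp
  qed
  moreover have "A v \<in> span S" for v
  proof -
    have "A v = (\<Sum>j\<in>UNIV. v $ j *\<^sub>R col j)"
      unfolding fun_cong[OF matrix_vector_mul(2)[OF lin], of v, symmetric]
      by (simp add: vec_eq_iff matrix_vector_mult_def col mult.commute)
    also have "\<dots> \<in> span S"
      using S(3) by (intro span_sum span_scale) auto
    finally show ?thesis .
  qed
  ultimately have ABA: "A (B (A v)) = A v" for v by blast
  have "(norm (B u))\<^sup>2 \<le> real CARD('n) * (c ^ (CARD('n) - 1) * norm u)\<^sup>2" for u
  proof -
    let ?b = "(c ^ (CARD('n) - 1) * norm u)\<^sup>2"
    \<comment> \<open>Distinct rows come from distinct columns of \<open>A\<close>, so the summands of \<open>B u\<close> are orthogonal.\<close>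
    have "(norm (B u))\<^sup>2 = (\<Sum>i\<in>I. (norm ((u v* N) $ i *\<^sub>R axis (h i) (1::real)))\<^sup>2)"
      unfolding B_def using h_inj
      by (intro norm_sum_Pythagorean)
         (auto simp: pairwise_def orthogonal_def inner_axis_axis inj_on_def)
    also have "\<dots> = (\<Sum>i\<in>I. \<bar>(u v* N) $ i\<bar>\<^sup>2)"
      by (simp add: norm_axis_1)
    also have "\<dots> \<le> (\<Sum>i\<in>I. ?b)"
      by (intro sum_mono power_mono coord) auto
    also have "\<dots> \<le> real CARD('n) * ?b"
      by (simp add: mult_right_mono card_mono)
    finally show ?thesis .
  qed
  with linB ABA show ?thesis by (rule that)
qed

theorem lemma4p2:
  fixes A :: "real ^ 'm \<Rightarrow> real ^ 'n" and k :: int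
  assumes "linear A"
    and "\<And>i j. matrix A $ i $ j \<in> {-1, 0, 1}"
    and "\<And>j. int (card {i. matrix A $ i $ j \<noteq> 0}) \<le> k"
    and "\<And>i. int (card {j. matrix A $ i $ j \<noteq> 0}) \<le> k"
  shows "\<exists>B :: real ^ 'n \<Rightarrow> real ^ 'm. linear B \<and>
           (\<forall>v. A (B (A v)) = A v) \<and>
           (\<forall>u. (norm (B u))\<^sup>2 \<le>
                  real CARD('n) * real_of_int k ^ (2 * CARD('n)) * (norm u)\<^sup>2)"
proof (cases "k \<le> 0")
  case True
  have "card {i. matrix A $ i $ j \<noteq> 0} = 0" for j
    using assms(3)[of j] True by linarith
  then have "matrix A = 0"
    by (auto simp: vec_eq_iff)
  then have "A v = 0" for v
    using fun_cong[OF matrix_vector_mul(2)[OF assms(1)], of v] by simp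
  then show ?thesis
    by (intro exI[of _ "\<lambda>_. 0"]) (auto simp: linear_zero zero_le_mult_iff)
next
  case False
  have entry: "matrix A $ i $ j \<in> \<int>"
    "\<bar>matrix A $ i $ j\<bar> = (if matrix A $ i $ j \<noteq> 0 then 1 else 0)" for i j
    using assms(2)[of i j] by auto
  have l1: "(\<Sum>i\<in>UNIV. \<bar>matrix A $ i $ j\<bar>) \<le> real_of_int k" for j
  proof -
    have "(\<Sum>i\<in>UNIV. \<bar>matrix A $ i $ j\<bar>) = real (card {i. matrix A $ i $ j \<noteq> 0})"
      by (simp add: entry(2) sum.If_cases)
    then show ?thesis using assms(3)[of j] by linarith
  qed
  have k1: "1 \<le> real_of_int k" using False by simp
  obtain B :: "real ^ 'n \<Rightarrow> real ^ 'm" where B: "linear B" "\<And>v. A (B (A v)) = A v"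
    "\<And>u. (norm (B u))\<^sup>2 \<le> real CARD('n) * (real_of_int k ^ (CARD('n) - 1) * norm u)\<^sup>2"
    using integral_operator_has_bounded_generalized_inverse[OF assms(1) entry(1) k1 l1] by blast
  have "(norm (B u))\<^sup>2 \<le> real CARD('n) * real_of_int k ^ (2 * CARD('n)) * (norm u)\<^sup>2" for u
  proof -
    have "real_of_int k ^ (2 * (CARD('n) - 1)) \<le> real_of_int k ^ (2 * CARD('n))"
      using False by (intro power_increasing) auto
    then have "real CARD('n) * (real_of_int k ^ (CARD('n) - 1) * norm u)\<^sup>2
        \<le> real CARD('n) * real_of_int k ^ (2 * CARD('n)) * (norm u)\<^sup>2"
      by (simp add: power_mult_distrib power_even_eq mult.assoc mult_left_mono mult_right_mono)
    with B(3)[of u] show ?thesis by linarith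
  qed
  with B(1,2) show ?thesis by blast
qed

end
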